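(* There is an absolute constant $C>0$ such that the following holds. Consider the problem $\min_{x\in\mathbb{R}^d}F(x)$, $F=f+\psi$, where $F$ is bounded below by $F^\star\in\mathbb{R}$, $f$ is $L$-smooth, and the stochastic gradient oracle of $f$ is unbiased with variance at most $\sigma^2$. Let $\varepsilon>0$ be a target error, let $F_0:=F(x_0)-F^\star$ and $\Phi_0:=F_0+\frac{\sqrt2}{8L}\mathbb{E}\|m_0-\nabla f(x_0)\|^2$, and assume $\Phi_0>0$. Then there is a number of iterations $$K=\mathcal{O}\Bigl(\frac{L\Phi_0\sigma^2}{\varepsilon^2}+\frac{L\Phi_0}{\varepsilon}\Bigr),\qquad\text{i.e. an integer } 1\le K\le\Bigl\lceil C\Bigl(\frac{L\Phi_0\sigma^2}{\varepsilon^2}+\frac{L\Phi_0}{\varepsilon}\Bigr)\Bigr\rceil,$$ such that if the proximal gradient method with Polyak momentum and exact proximal steps is run for $K$ iterations with constant coefficients $M_k=M:=(1+3\sqrt2)L+\frac{3^{3/2}}{2^{3/4}}\sqrt{\frac{KL\sigma^2}{\Phi_0}}$ and $\gamma_k=\frac{3\sqrt2L}{M-L}$ for $0\le k\le K-1$, then for $x_t$ chosen uniformly at random from $\{x_1,\dots,x_K\}$ (with $t$ uniform on $\{1,\dots,K\}$, independent of everything else) we have $\mathbb{E}\|m_t-\nabla f(x_t)\|^2\le\varepsilon$.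
   Context: Setting. $d\ge1$, $L>0$, $\sigma\ge0$; $\|\cdot\|$ is the Euclidean norm. $f:\mathbb{R}^d\to\mathbb{R}$ and $\psi:\mathbb{R}^d\to\mathbb{R}$ are differentiable (convexity is not assumed), and $F:=f+\psi$. "$F$ is bounded below by $F^\star$" means $F^\star\le F(x)$ for all $x$. "$f$ is $L$-smooth" means $\|\nabla f(x)-\nabla f(y)\|\le L\|x-y\|$ for all $x,y$. "The oracle is unbiased with variance at most $\sigma^2$" means that a random vector $\nabla f(x,\xi)$ is available with $\mathbb{E}[\nabla f(x,\xi)]=\nabla f(x)$ and $\mathbb{E}\|\nabla f(x,\xi)-\nabla f(x)\|^2\le\sigma^2$ for every $x$. Proximal gradient method with Polyak momentum. Inputs: a deterministic $x_0\in\mathbb{R}^d$, a (possibly random) vector $m_{-1}$, deterministic $M_k>0$ ($k\ge0$) and $\gamma_k$ ($k\ge-1$). For $k=0,1,2,\dots$: compute $g_k=\nabla f(x_k,\xi_k)$ with a fresh sample $\xi_k$ (for each $k\ge0$, $\xi_{k+1}$ is independent of $x_0,\dots,x_{k+1},m_{-1},\dots,m_k$); set $m_k=(1-\gamma_{k-1})m_{k-1}+\gamma_{k-1}g_k$; with $\Omega_k(x):=\langle m_k,x\rangle+\psi(x)+\frac{M_k}{2}\|x-x_k\|^2$, compute a (random) point $x_{k+1}$ with $\Omega_k(x_{k+1})\le\Omega_k(x_k)$. "Exact proximal steps" means that moreover $\nabla\Omega_k(x_{k+1})=0$ for every $k$. The vector $m_K=(1-\gamma_{K-1})m_{K-1}+\gamma_{K-1}g_K$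 is formed with one further sample $g_K=\nabla f(x_K,\xi_K)$. *)

theory Defs
  imports "HOL-Probability.Probability"
begin

definition grad :: "('a::euclidean_space \<Rightarrow> real) \<Rightarrow> 'a \<Rightarrow> 'a" where
  "grad f x = (THE D. GDERIV f x :> D)"

lemma grad_eqI:
  assumes "GDERIV f x :> D"
  shows "grad f x = D"
  unfolding grad_def
proof (rule the_equality)
  show "GDERIV f x :> D" by (fact assms)
next
  fix E assume "GDERIV f x :> E"
  with assms have "(\<lambda>h. h \<bullet> E) = (\<lambda>h. h \<bullet> D)"
    unfolding gderiv_def by (metis has_derivative_unique)
  then have "\<And>h. h \<bullet> E = h \<bullet> D" by metis
  then show "E = D" by (metis vector_eq_ldot)
qed

lemma gderiv_grad:
  assumes "f differentiable (at x)"
  shows "GDERIV f x :> grad f x"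
proof -
  obtain f' where f': "(f has_derivative f') (at x)"
    using assms unfolding differentiable_def by blast
  then interpret f': bounded_linear f' by (rule has_derivative_bounded_linear)
  have "f' h = h \<bullet> (\<Sum>b\<in>Basis. f' b *\<^sub>R b)" for h
  proof -
    have "f' h = f' (\<Sum>b\<in>Basis. (h \<bullet> b) *\<^sub>R b)" by (simp add: euclidean_representation)
    also have "\<dots> = (\<Sum>b\<in>Basis. (h \<bullet> b) * f' b)" by (simp add: f'.sum f'.scaleR)
    also have "\<dots> = h \<bullet> (\<Sum>b\<in>Basis. f' b *\<^sub>R b)"
      by (simp add: inner_sum_right mult.commute)
    finally show ?thesis .
  qed
  then have "f' = (\<lambda>h. h \<bullet> (\<Sum>b\<in>Basis. f' b *\<^sub>R b))" by blast
  with f' have "GDERIV f x :> (\<Sum>b\<in>Basis. f' b *\<^sub>R b)"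
    unfolding gderiv_def by metis
  then show ?thesis using grad_eqI by metis
qed

definition L_smooth :: "real \<Rightarrow> ('a::euclidean_space \<Rightarrow> real) \<Rightarrow> bool" where
  "L_smooth L f \<longleftrightarrow> (\<forall>x y. norm (grad f x - grad f y) \<le> L * norm (x - y))"

text \<open>
  A stochastic gradient oracle is a jointly measurable map \<open>G\<close>, with \<open>G x s\<close> the stochastic
  gradient at the point \<open>x\<close> for the sample \<open>s\<close>, where samples have law \<open>D\<close>.  Integrability is
  stated explicitly because the Bochner integral of a non-integrable function is 0.
\<close>

definition unbiased_oracle ::
  "'s measure \<Rightarrow> ('a::euclidean_space \<Rightarrow> 's \<Rightarrow> 'a) \<Rightarrow> ('a \<Rightarrow> real) \<Rightarrow> real \<Rightarrow> bool" where
  "unbiased_oracle D G f \<sigma> \<longleftrightarrow>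
     prob_space D \<and>
     (\<lambda>(x, s). G x s) \<in> borel_measurable (borel \<Otimes>\<^sub>M D) \<and>
     (\<forall>x. integrable D (G x) \<and> (\<integral>s. G x s \<partial>D) = grad f x \<and>
          integrable D (\<lambda>s. (norm (G x s - grad f x))\<^sup>2) \<and>
          (\<integral>s. (norm (G x s - grad f x))\<^sup>2 \<partial>D) \<le> \<sigma>\<^sup>2)"

definition samples_from :: "'s measure \<Rightarrow> 'w measure \<Rightarrow> (nat \<Rightarrow> 'w \<Rightarrow> 's) \<Rightarrow> bool" where
  "samples_from D P \<xi> \<longleftrightarrow> (\<forall>k. \<xi> k \<in> measurable P D \<and> distr P D (\<xi> k) = D)"

definition prox_model ::
  "('a::euclidean_space \<Rightarrow> real) \<Rightarrow> real \<Rightarrow> 'a \<Rightarrow> 'a \<Rightarrow> 'a \<Rightarrow> real" where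
  "prox_model \<psi> M m y x = m \<bullet> x + \<psi> x + M / 2 * (norm (x - y))\<^sup>2"

definition polyak_update :: "real \<Rightarrow> 'a::euclidean_space \<Rightarrow> 'a \<Rightarrow> 'a" where
  "polyak_update \<gamma> m g = (1 - \<gamma>) *\<^sub>R m + \<gamma> *\<^sub>R g"

text \<open>
  The library constant \<open>indep_var\<close> forces both random variables to have values in the same type;
  here the generated sigma-algebras are required to be independent.
\<close>

definition indep_rvs ::
  "'w measure \<Rightarrow> 'b measure \<Rightarrow> ('w \<Rightarrow> 'b) \<Rightarrow> 'c measure \<Rightarrow> ('w \<Rightarrow> 'c) \<Rightarrow> bool" where
  "indep_rvs P N X N' Y \<longleftrightarrow>
     X \<in> measurable P N \<and> Y \<in> measurable P N' \<and>
     prob_space.indep_set P (sets (vimage_algebra (space P) X N)) (sets (vimage_algebra (space P) Y N'))"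

text \<open>
  \<open>K\<close> iterations on the probability space \<open>P\<close>, producing \<open>x 0, \<dots>, x K\<close> and \<open>m 0, \<dots>, m K\<close>.
  The quantities with index \<open>-1\<close> are the separate arguments \<open>mi\<close> (initial momentum vector) and
  \<open>\<gamma>i\<close> (the coefficient used to form \<open>m 0\<close>).  The samples are only required to be independent of
  the past from index 1 on, so \<open>\<xi> 0\<close> and \<open>mi\<close> may be dependent.
\<close>

definition prox_polyak_run ::
  "'w measure \<Rightarrow> 's measure \<Rightarrow> ('a::euclidean_space \<Rightarrow> 's \<Rightarrow> 'a) \<Rightarrow> ('a \<Rightarrow> real) \<Rightarrow>
   (nat \<Rightarrow> 'w \<Rightarrow> 's) \<Rightarrow> 'a \<Rightarrow> ('w \<Rightarrow> 'a) \<Rightarrow> real \<Rightarrow> (nat \<Rightarrow> real) \<Rightarrow> (nat \<Rightarrow> real) \<Rightarrow> nat \<Rightarrow>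
   (nat \<Rightarrow> 'w \<Rightarrow> 'a) \<Rightarrow> (nat \<Rightarrow> 'w \<Rightarrow> 'a) \<Rightarrow> bool" where
  "prox_polyak_run P D G \<psi> \<xi> x0 mi \<gamma>i M \<gamma> K x m \<longleftrightarrow>
     (\<forall>k<K. 0 < M k) \<and>
     (\<forall>k\<le>K. x k \<in> borel_measurable P) \<and>
     (\<forall>\<omega>\<in>space P. x 0 \<omega> = x0) \<and>
     (\<forall>\<omega>\<in>space P. m 0 \<omega> = polyak_update \<gamma>i (mi \<omega>) (G (x 0 \<omega>) (\<xi> 0 \<omega>))) \<and>
     (\<forall>k<K. \<forall>\<omega>\<in>space P.
        m (Suc k) \<omega> = polyak_update (\<gamma> k) (m k \<omega>) (G (x (Suc k) \<omega>) (\<xi> (Suc k) \<omega>))) \<and>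
     (\<forall>k<K. \<forall>\<omega>\<in>space P.
        prox_model \<psi> (M k) (m k \<omega>) (x k \<omega>) (x (Suc k) \<omega>)
        \<le> prox_model \<psi> (M k) (m k \<omega>) (x k \<omega>) (x k \<omega>)) \<and>
     (\<forall>k<K. indep_rvs P D (\<xi> (Suc k))
        (borel \<Otimes>\<^sub>M (\<Pi>\<^sub>M i\<in>{..Suc k}. borel) \<Otimes>\<^sub>M (\<Pi>\<^sub>M i\<in>{..k}. borel))
        (\<lambda>\<omega>. (mi \<omega>, \<lambda>i\<in>{..Suc k}. x i \<omega>, \<lambda>i\<in>{..k}. m i \<omega>)))"

definition exact_prox_steps ::
  "'w measure \<Rightarrow> ('a::euclidean_space \<Rightarrow> real) \<Rightarrow> (nat \<Rightarrow> real) \<Rightarrow> nat \<Rightarrow>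
   (nat \<Rightarrow> 'w \<Rightarrow> 'a) \<Rightarrow> (nat \<Rightarrow> 'w \<Rightarrow> 'a) \<Rightarrow> bool" where
  "exact_prox_steps P \<psi> M K x m \<longleftrightarrow>
     (\<forall>k<K. \<forall>\<omega>\<in>space P. grad (prox_model \<psi> (M k) (m k \<omega>) (x k \<omega>)) (x (Suc k) \<omega>) = 0)"

text \<open>
  The mean of \<open>Z t\<close> for \<open>t\<close> uniform on \<open>{1..K}\<close> and independent of everything living on \<open>P\<close>:
  \<open>t\<close> is the first coordinate of the product space.  Its space is \<open>{1..K}\<close>, so that the behaviour
  of the processes after time \<open>K\<close>, on which a run puts no condition, is irrelevant even for
  measurability.
\<close>

abbreviation with_uniform_index :: "nat \<Rightarrow> 'w measure \<Rightarrow> (nat \<times> 'w) measure" where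
  "with_uniform_index K P \<equiv> uniform_count_measure {1..K} \<Otimes>\<^sub>M P"

text \<open>
  In a theorem \<open>\<exists>C>0. \<dots>\<close> whose dimension and sample spaces are types, \<open>C\<close> could depend on these
  types, because they cannot be quantified inside the scope of \<open>\<exists>\<close>.  That \<open>C\<close> is absolute is
  therefore expressed by a numerical bound that is the same for all types.  Admissibility of \<open>C\<close>
  as a factor in an upper bound is preserved when \<open>C\<close> grows, so it is enough to exclude large values.
\<close>

definition absolute_const :: "real \<Rightarrow> bool" where
  "absolute_const C \<longleftrightarrow> 0 < C \<and> C \<le> 1000"

end

theory Submission
  imports Defs
begin

text \<open>
  Let \<open>E k\<close> be the mean squared error of the momentum vector \<open>m k\<close> as an estimate of
  \<open>grad f (x k)\<close>.  Two inequalities feed each other.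

  The first is decrease of the objective (\<open>prox_model_decrease\<close>): a step that does not increase
  the proximal model lowers \<open>f + \<psi>\<close> by \<open>(M - L) / 4\<close> times the squared step length, up to the
  squared momentum error divided by \<open>M - L\<close>.  Telescoping bounds the total squared step length by
  the initial gap and the total error.

  The second is contraction of the error (\<open>sq_err_step\<close>): a fresh sample is unbiased given the
  past, so its noise enters \<open>E (k + 1)\<close> only as \<open>\<gamma>\<^sup>2 * \<sigma>\<^sup>2\<close>, while the old error is multiplied by
  \<open>1 - \<gamma>\<close> and the drift of the gradient costs \<open>L\<^sup>2 / \<gamma>\<close> times the squared step length.

  The relation \<open>\<gamma> * (M - L) = 3 * sqrt 2 * L\<close> makes the loop gain of the two inequalities \<open>2 / 9\<close>,
  hence \<open>\<gamma> * (E 1 + \<dots> + E K)\<close> is at most a constant times \<open>L * \<Phi>0 + K * \<gamma>\<^sup>2 * \<sigma>\<^sup>2\<close>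
  (\<open>sum_sq_err_le\<close>).  The prescribed \<open>M\<close> balances these two terms, which gives the rate
  \<open>8 * (L * \<Phi>0 / K) + 8 * sqrt (L * \<Phi>0 * \<sigma>\<^sup>2 / K)\<close> for the average error
  (\<open>average_error_rate\<close>).  It is at most \<open>\<epsilon>\<close> as soon as \<open>K\<close> is at least \<open>100\<close> times
  \<open>L * \<Phi>0 * \<sigma>\<^sup>2 / \<epsilon>\<^sup>2 + L * \<Phi>0 / \<epsilon>\<close>.
\<close>

section \<open>Smooth functions and the proximal step\<close>

lemma L_smooth_continuous_grad:
  fixes f :: "'a::euclidean_space \<Rightarrow> real"
  assumes "0 \<le> L" "L_smooth L f"
  shows "continuous_on UNIV (grad f)"
proof -
  have "L-lipschitz_on UNIV (grad f)"
    using assms by (intro lipschitz_onI) (auto simp: L_smooth_def dist_norm)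
  then show ?thesis by (rule lipschitz_on_continuous_on)
qed

lemma L_smooth_upper_bound:
  fixes f :: "'a::euclidean_space \<Rightarrow> real"
  assumes diff: "\<And>x. f differentiable (at x)" and smooth: "L_smooth L f"
  shows "f y \<le> f x + grad f x \<bullet> (y - x) + L / 2 * (norm (y - x))\<^sup>2"
proof -
  define d where "d = y - x"
  define \<phi> where "\<phi> t = f (x + t *\<^sub>R d) - t * (grad f x \<bullet> d) - L / 2 * t\<^sup>2 * (norm d)\<^sup>2" for t
  have der: "(\<phi> has_real_derivative
      (grad f (x + t *\<^sub>R d) - grad f x) \<bullet> d - L * t * (norm d)\<^sup>2) (at t)" for t
  proof -
    have "(f has_derivative (\<lambda>h. h \<bullet> grad f (x + t *\<^sub>R d))) (at (x + t *\<^sub>R d))"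
      using gderiv_grad[OF diff] unfolding gderiv_def .
    moreover have "((\<lambda>t. x + t *\<^sub>R d) has_derivative (\<lambda>h. h *\<^sub>R d)) (at t)"
      by (auto intro!: derivative_eq_intros)
    ultimately have "((\<lambda>t. f (x + t *\<^sub>R d)) has_derivative
        (\<lambda>h. (h *\<^sub>R d) \<bullet> grad f (x + t *\<^sub>R d))) (at t)"
      by (rule has_derivative_compose[rotated])
    then have "((\<lambda>t. f (x + t *\<^sub>R d)) has_real_derivative grad f (x + t *\<^sub>R d) \<bullet> d) (at t)"
      by (simp add: has_field_derivative_def inner_commute mult.commute[of _ "d \<bullet> _"])
    then show ?thesis
      unfolding \<phi>_def by (auto intro!: derivative_eq_intros simp: inner_diff_left)
  qed
  have "\<phi> 1 \<le> \<phi> 0"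
  proof (rule DERIV_nonpos_imp_nonincreasing[where f = \<phi> and a = 0 and b = 1])
    fix t :: real assume t: "0 \<le> t" "t \<le> 1"
    have lip: "norm (grad f (x + t *\<^sub>R d) - grad f x) \<le> L * norm (x + t *\<^sub>R d - x)"
      using smooth unfolding L_smooth_def by blast
    have "(grad f (x + t *\<^sub>R d) - grad f x) \<bullet> d \<le> norm (grad f (x + t *\<^sub>R d) - grad f x) * norm d"
      by (rule norm_cauchy_schwarz)
    also have "\<dots> \<le> (L * norm (x + t *\<^sub>R d - x)) * norm d"
      by (intro mult_right_mono lip norm_ge_zero)
    also have "\<dots> = L * t * (norm d)\<^sup>2" using t by (simp add: power2_eq_square)
    finally show "\<exists>D. (\<phi> has_real_derivative D) (at t) \<and> D \<le> 0" using der[of t] by force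
  qed simp
  then show ?thesis by (simp add: \<phi>_def d_def)
qed

text \<open>
  Adding the smoothness bound for \<open>f\<close> to the decrease of the proximal model leaves only the
  momentum error \<open>m - grad f x\<close> paired with the step.  Young's inequality charges that product
  to one half of the available quadratic decrease.
\<close>

lemma prox_model_decrease:
  fixes f \<psi> :: "'a::euclidean_space \<Rightarrow> real"
  assumes diff: "\<And>x. f differentiable (at x)" and smooth: "L_smooth L f" and "L < M"
    and dec: "prox_model \<psi> M m x y \<le> prox_model \<psi> M m x x"
  shows "f y + \<psi> y + (M - L) / 4 * (norm (y - x))\<^sup>2
           \<le> f x + \<psi> x + (norm (m - grad f x))\<^sup>2 / (M - L)"
proof -
  define N where "N = M - L"
  have N: "N > 0" using assms by (simp add: N_def)
  define e where "e = m - grad f x"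
  define d where "d = y - x"
  have "0 \<le> (norm ((1/N) *\<^sub>R e + (1/2) *\<^sub>R d))\<^sup>2" by simp
  also have "\<dots> = (norm e)\<^sup>2 / N\<^sup>2 + (e \<bullet> d) / N + (norm d)\<^sup>2 / 4"
    unfolding power2_norm_eq_inner
    by (simp add: inner_add_left inner_add_right inner_commute power2_eq_square)
  finally have "0 \<le> N * ((norm e)\<^sup>2 / N\<^sup>2 + (e \<bullet> d) / N + (norm d)\<^sup>2 / 4)" using N by simp
  also have "\<dots> = (norm e)\<^sup>2 / N + e \<bullet> d + N / 4 * (norm d)\<^sup>2"
    using N by (simp add: field_simps power2_eq_square)
  finally have young: "0 \<le> (norm e)\<^sup>2 / N + e \<bullet> d + N / 4 * (norm d)\<^sup>2" .
  have "m \<bullet> d + \<psi> y + M / 2 * (norm d)\<^sup>2 \<le> \<psi> x"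
    using dec by (simp add: prox_model_def d_def inner_diff_right)
  moreover have "f y \<le> f x + grad f x \<bullet> d + L / 2 * (norm d)\<^sup>2"
    using L_smooth_upper_bound[OF diff smooth] by (simp add: d_def)
  moreover have "e \<bullet> d = m \<bullet> d - grad f x \<bullet> d" by (simp add: e_def inner_diff_left)
  moreover have "M / 2 * (norm d)\<^sup>2 = N / 2 * (norm d)\<^sup>2 + L / 2 * (norm d)\<^sup>2"
    by (simp add: N_def field_simps)
  ultimately have "f y + \<psi> y + N / 4 * (norm d)\<^sup>2 \<le> f x + \<psi> x + (norm e)\<^sup>2 / N"
    using young by argo
  then show ?thesis by (simp add: N_def e_def d_def)
qed

section \<open>One momentum update\<close>

text \<open>
  Convexity of the squared norm along \<open>(1 - \<gamma>) *\<^sub>R u + \<gamma> *\<^sub>R (((1 - \<gamma>) / \<gamma>) *\<^sub>R v)\<close>: the old error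
  keeps a contraction factor, at the price \<open>1 / \<gamma>\<close> on the drift \<open>v\<close> of the gradient.
\<close>

lemma norm_contraction_drift:
  fixes u v :: "'a::real_inner"
  assumes "0 < \<gamma>" "\<gamma> \<le> 1"
  shows "(1 - \<gamma>)\<^sup>2 * (norm (u + v))\<^sup>2 \<le> (1 - \<gamma>) * (norm u)\<^sup>2 + 1 / \<gamma> * (norm v)\<^sup>2"
proof -
  define w where "w = ((1 - \<gamma>) / \<gamma>) *\<^sub>R v"
  have "0 \<le> (1 - \<gamma>) * \<gamma> * (norm (u - w))\<^sup>2" using assms by simp
  also have "\<dots> = (1 - \<gamma>) * (norm u)\<^sup>2 + \<gamma> * (norm w)\<^sup>2 - (norm ((1 - \<gamma>) *\<^sub>R u + \<gamma> *\<^sub>R w))\<^sup>2"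
    unfolding power2_norm_eq_inner
    by (simp add: inner_diff inner_add_left inner_add_right inner_commute) algebra
  also have "(1 - \<gamma>) *\<^sub>R u + \<gamma> *\<^sub>R w = (1 - \<gamma>) *\<^sub>R (u + v)"
    using assms by (simp add: w_def scaleR_add_right)
  also have "(norm \<dots>)\<^sup>2 = (1 - \<gamma>)\<^sup>2 * (norm (u + v))\<^sup>2" by (simp add: power_mult_distrib)
  finally have "(1 - \<gamma>)\<^sup>2 * (norm (u + v))\<^sup>2 \<le> (1 - \<gamma>) * (norm u)\<^sup>2 + \<gamma> * (norm w)\<^sup>2" by simp
  also have "\<gamma> * (norm w)\<^sup>2 = (1 - \<gamma>)\<^sup>2 * (1 / \<gamma> * (norm v)\<^sup>2)"
    using assms by (simp add: w_def power_mult_distrib field_simps power2_eq_square)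
  also have "\<dots> \<le> 1 * (1 / \<gamma> * (norm v)\<^sup>2)"
    using assms by (intro mult_right_mono) (auto simp: power_le_one)
  finally show ?thesis by simp
qed

text \<open>
  For a fixed query point the noise has mean zero, so the cross term vanishes.  The bound is an
  extended nonnegative integral: it can be integrated once more over the random query point
  without any integrability being known beforehand.
\<close>

lemma polyak_update_second_moment:
  fixes G :: "'a::euclidean_space \<Rightarrow> 's \<Rightarrow> 'a"
  assumes "unbiased_oracle D G f \<sigma>"
  shows "(\<integral>\<^sup>+ s. ennreal ((norm (polyak_update \<gamma> m (G y s) - grad f y))\<^sup>2) \<partial>D)
           \<le> ennreal ((1 - \<gamma>)\<^sup>2 * (norm (m - grad f y))\<^sup>2 + \<gamma>\<^sup>2 * \<sigma>\<^sup>2)"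
proof -
  interpret D: prob_space D using assms by (simp add: unbiased_oracle_def)
  define u where "u = m - grad f y"
  define n where "n s = G y s - grad f y" for s
  have int_G: "integrable D (G y)" and mean_G: "(\<integral>s. G y s \<partial>D) = grad f y"
    and int_n2: "integrable D (\<lambda>s. (norm (n s))\<^sup>2)"
    and var: "(\<integral>s. (norm (n s))\<^sup>2 \<partial>D) \<le> \<sigma>\<^sup>2"
    using assms by (auto simp: unbiased_oracle_def n_def)
  have int_n: "integrable D n" unfolding n_def using int_G by simp
  have mean_n: "(\<integral>s. n s \<partial>D) = 0"
    unfolding n_def using int_G mean_G by (simp add: D.prob_space)
  have expand: "(norm (polyak_update \<gamma> m (G y s) - grad f y))\<^sup>2
      = (1 - \<gamma>)\<^sup>2 * (norm u)\<^sup>2 + 2 * (1 - \<gamma>) * \<gamma> * (u \<bullet> n s) + \<gamma>\<^sup>2 * (norm (n s))\<^sup>2" for s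
  proof -
    have update: "polyak_update \<gamma> m (G y s) - grad f y = (1 - \<gamma>) *\<^sub>R u + \<gamma> *\<^sub>R n s"
      by (simp add: polyak_update_def u_def n_def algebra_simps)
    show ?thesis
      unfolding update power2_norm_eq_inner
      by (simp add: inner_add_left inner_add_right inner_commute power2_eq_square algebra_simps)
  qed
  have int: "integrable D (\<lambda>s. (norm (polyak_update \<gamma> m (G y s) - grad f y))\<^sup>2)"
    unfolding expand using int_n int_n2 by (intro Bochner_Integration.integrable_add) auto
  have "(\<integral>s. (norm (polyak_update \<gamma> m (G y s) - grad f y))\<^sup>2 \<partial>D)
      = (1 - \<gamma>)\<^sup>2 * (norm u)\<^sup>2 + 2 * (1 - \<gamma>) * \<gamma> * (u \<bullet> (\<integral>s. n s \<partial>D))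
        + \<gamma>\<^sup>2 * (\<integral>s. (norm (n s))\<^sup>2 \<partial>D)"
    unfolding expand using int_n int_n2 by (simp add: D.prob_space)
  also have "\<dots> \<le> (1 - \<gamma>)\<^sup>2 * (norm u)\<^sup>2 + \<gamma>\<^sup>2 * \<sigma>\<^sup>2"
    using var by (simp add: mean_n mult_left_mono)
  finally show ?thesis
    using int unfolding u_def by (subst nn_integral_eq_integral) (auto intro: ennreal_leI simp del: ennreal_plus)
qed

text \<open>
  The function \<open>h\<close> extracts from the recorded past \<open>Y\<close> the part that an update uses, so that the
  product law can be stated without the product spaces that record the whole history.
\<close>

lemma indep_rvs_distr_pair:
  assumes P: "prob_space P" and ind: "indep_rvs P N X N' Y" and h: "h \<in> measurable N' Q"
  shows "distr P (Q \<Otimes>\<^sub>M N) (\<lambda>\<omega>. (h (Y \<omega>), X \<omega>)) = distr P Q (\<lambda>\<omega>. h (Y \<omega>)) \<Otimes>\<^sub>M distr P N X"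
proof -
  interpret prob_space P by fact
  have X: "X \<in> measurable P N" and Y: "Y \<in> measurable P N'"
    and iset: "indep_set (sets (vimage_algebra (space P) X N)) (sets (vimage_algebra (space P) Y N'))"
    using ind by (auto simp: indep_rvs_def)
  have hY: "(\<lambda>\<omega>. h (Y \<omega>)) \<in> measurable P Q" using Y h by simp
  interpret A: prob_space "distr P Q (\<lambda>\<omega>. h (Y \<omega>))" by (rule prob_space_distr) fact
  interpret B: prob_space "distr P N X" by (rule prob_space_distr) fact
  show ?thesis
  proof (rule pair_measure_eqI[symmetric])
    fix A B assume A: "A \<in> sets (distr P Q (\<lambda>\<omega>. h (Y \<omega>)))" and B: "B \<in> sets (distr P N X)"
    have "h -` A \<inter> space N' \<in> sets N'" using A h by (auto intro: measurable_sets)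
    then have "Y -` (h -` A \<inter> space N') \<inter> space P \<in> sets (vimage_algebra (space P) Y N')"
      by (rule in_vimage_algebra)
    also have "Y -` (h -` A \<inter> space N') \<inter> space P = (\<lambda>\<omega>. h (Y \<omega>)) -` A \<inter> space P"
      using measurable_space[OF Y] by auto
    finally have *: "prob ((X -` B \<inter> space P) \<inter> ((\<lambda>\<omega>. h (Y \<omega>)) -` A \<inter> space P))
        = prob (X -` B \<inter> space P) * prob ((\<lambda>\<omega>. h (Y \<omega>)) -` A \<inter> space P)"
      using B by (intro indep_setD[OF iset]) (auto intro: in_vimage_algebra)
    have "(\<lambda>\<omega>. (h (Y \<omega>), X \<omega>)) -` (A \<times> B) \<inter> space P
        = (X -` B \<inter> space P) \<inter> ((\<lambda>\<omega>. h (Y \<omega>)) -` A \<inter> space P)" by auto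
    then show "emeasure (distr P Q (\<lambda>\<omega>. h (Y \<omega>))) A * emeasure (distr P N X) B
        = emeasure (distr P (Q \<Otimes>\<^sub>M N) (\<lambda>\<omega>. (h (Y \<omega>), X \<omega>))) (A \<times> B)"
      using A B X hY *
      by (simp add: emeasure_distr emeasure_eq_measure mult.commute flip: ennreal_mult)
  qed (auto intro: A.sigma_finite_measure_axioms B.sigma_finite_measure_axioms)
qed

text \<open>
  The one-step error bound.  By the product law the fresh sample can be integrated out first,
  with the past held fixed; this replaces conditional expectations.
\<close>

lemma polyak_update_expected_error:
  fixes G :: "'a::euclidean_space \<Rightarrow> 's \<Rightarrow> 'a" and \<gamma> :: real
  assumes P: "prob_space P" and orc: "unbiased_oracle D G f \<sigma>"
    and X: "X \<in> measurable P D" "distr P D X = D"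
    and grad_meas: "grad f \<in> borel_measurable borel"
    and ind: "indep_rvs P D X N' Y"
    and h: "h \<in> measurable N' (borel \<Otimes>\<^sub>M borel)"
    and hY: "\<And>\<omega>. \<omega> \<in> space P \<Longrightarrow> h (Y \<omega>) = (y \<omega>, \<mu> \<omega>)"
    and int: "integrable P (\<lambda>\<omega>. (norm (\<mu> \<omega> - grad f (y \<omega>)))\<^sup>2)"
  defines "new \<equiv> \<lambda>\<omega>. (norm (polyak_update \<gamma> (\<mu> \<omega>) (G (y \<omega>) (X \<omega>)) - grad f (y \<omega>)))\<^sup>2"
  shows "integrable P new"
    and "(\<integral>\<omega>. new \<omega> \<partial>P) \<le> (1 - \<gamma>)\<^sup>2 * (\<integral>\<omega>. (norm (\<mu> \<omega> - grad f (y \<omega>)))\<^sup>2 \<partial>P) + \<gamma>\<^sup>2 * \<sigma>\<^sup>2"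
proof -
  interpret prob_space P by fact
  interpret D: prob_space D using orc by (simp add: unbiased_oracle_def)
  let ?Q = "borel \<Otimes>\<^sub>M borel :: ('a \<times> 'a) measure"
  let ?bound = "(1 - \<gamma>)\<^sup>2 * (\<integral>\<omega>. (norm (\<mu> \<omega> - grad f (y \<omega>)))\<^sup>2 \<partial>P) + \<gamma>\<^sup>2 * \<sigma>\<^sup>2"
  define g where "g = (\<lambda>((a, b), s). ennreal ((norm (polyak_update \<gamma> b (G a s) - grad f a))\<^sup>2))"
  have [measurable]: "(\<lambda>(x, s). G x s) \<in> borel_measurable (borel \<Otimes>\<^sub>M D)"
    using orc by (simp add: unbiased_oracle_def)
  note [measurable] = grad_meas X(1)
  have Y[measurable]: "Y \<in> measurable P N'" using ind by (simp add: indep_rvs_def)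
  have hYm: "(\<lambda>\<omega>. h (Y \<omega>)) \<in> measurable P ?Q" using Y h by simp
  have "(\<lambda>\<omega>. (y \<omega>, \<mu> \<omega>)) \<in> measurable P ?Q"
    using hYm hY by (simp cong: measurable_cong)
  from measurable_compose[OF this measurable_fst] measurable_compose[OF this measurable_snd]
  have [measurable]: "y \<in> borel_measurable P" "\<mu> \<in> borel_measurable P" by simp_all
  have Gm[measurable]: "(\<lambda>w. G (fst (fst w)) (snd w)) \<in> borel_measurable (?Q \<Otimes>\<^sub>M D)"
  proof -
    have "(\<lambda>w. (fst (fst w), snd w)) \<in> measurable (?Q \<Otimes>\<^sub>M D) (borel \<Otimes>\<^sub>M D)" by measurable
    then have "(\<lambda>w. (\<lambda>(x, s). G x s) (fst (fst w), snd w)) \<in> borel_measurable (?Q \<Otimes>\<^sub>M D)"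
      by (rule measurable_compose) measurable
    then show ?thesis by simp
  qed
  have g_meas: "g \<in> borel_measurable (?Q \<Otimes>\<^sub>M D)"
    unfolding g_def case_prod_beta' polyak_update_def by measurable
  have pair_meas: "(\<lambda>\<omega>. (h (Y \<omega>), X \<omega>)) \<in> measurable P (?Q \<Otimes>\<^sub>M D)" using hYm by measurable
  have "(\<lambda>\<omega>. (y \<omega>, X \<omega>)) \<in> measurable P (borel \<Otimes>\<^sub>M D)" by measurable
  then have "(\<lambda>\<omega>. (\<lambda>(x, s). G x s) (y \<omega>, X \<omega>)) \<in> borel_measurable P"
    by (rule measurable_compose) measurable
  then have new_meas: "new \<in> borel_measurable P"
    unfolding new_def polyak_update_def by simp
  have new_pos: "new \<omega> \<ge> 0" for \<omega> by (simp add: new_def)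
  have "(\<integral>\<^sup>+ \<omega>. new \<omega> \<partial>P) = (\<integral>\<^sup>+ \<omega>. g (h (Y \<omega>), X \<omega>) \<partial>P)"
    by (intro nn_integral_cong) (simp add: g_def new_def hY)
  also have "\<dots> = (\<integral>\<^sup>+ w. g w \<partial>distr P (?Q \<Otimes>\<^sub>M D) (\<lambda>\<omega>. (h (Y \<omega>), X \<omega>)))"
    using pair_meas g_meas by (simp add: nn_integral_distr)
  also have "\<dots> = (\<integral>\<^sup>+ w. g w \<partial>(distr P ?Q (\<lambda>\<omega>. h (Y \<omega>)) \<Otimes>\<^sub>M D))"
    using indep_rvs_distr_pair[OF P ind h] X(2) by simp
  also have "\<dots> = (\<integral>\<^sup>+ z. (\<integral>\<^sup>+ s. g (z, s) \<partial>D) \<partial>distr P ?Q (\<lambda>\<omega>. h (Y \<omega>)))"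
    using g_meas by (intro D.nn_integral_fst[symmetric]) (simp cong: measurable_cong_sets)
  also have "\<dots> = (\<integral>\<^sup>+ \<omega>. (\<integral>\<^sup>+ s. g (h (Y \<omega>), s) \<partial>D) \<partial>P)"
    using hYm D.borel_measurable_nn_integral_fst[OF g_meas] by (simp add: nn_integral_distr)
  also have "\<dots> \<le> (\<integral>\<^sup>+ \<omega>. ennreal ((1 - \<gamma>)\<^sup>2 * (norm (\<mu> \<omega> - grad f (y \<omega>)))\<^sup>2 + \<gamma>\<^sup>2 * \<sigma>\<^sup>2) \<partial>P)"
    using polyak_update_second_moment[OF orc]
    by (intro nn_integral_mono) (simp add: hY g_def)
  also have "\<dots> = ennreal ?bound"
    using int by (subst nn_integral_eq_integral) (auto simp: prob_space)
  finally have le: "(\<integral>\<^sup>+ \<omega>. new \<omega> \<partial>P) \<le> ennreal ?bound" .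
  show "integrable P new"
    using new_meas le new_pos
    by (intro integrableI_bounded) (auto intro: le_less_trans)
  then have "ennreal (\<integral>\<omega>. new \<omega> \<partial>P) \<le> ennreal ?bound"
    using le new_pos by (simp add: nn_integral_eq_integral)
  then show "(\<integral>\<omega>. new \<omega> \<partial>P) \<le> ?bound"
    by (subst (asm) ennreal_le_iff) (auto intro!: add_nonneg_nonneg integral_nonneg_AE)
qed

section \<open>Summing along a run\<close>

text \<open>
  No relation between \<open>\<gamma>\<close> and \<open>M\<close> is imposed here: decrease and contraction hold for all values
  in the stated ranges, and the two are coupled only when these inequalities are combined.
\<close>

locale prox_polyak =
  fixes f \<psi> :: "'a::euclidean_space \<Rightarrow> real" and Fstar L \<sigma> :: real
    and D :: "'s measure" and G :: "'a \<Rightarrow> 's \<Rightarrow> 'a"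
    and P :: "'w measure" and \<xi> :: "nat \<Rightarrow> 'w \<Rightarrow> 's"
    and x0 :: 'a and mi :: "'w \<Rightarrow> 'a" and \<gamma>i M \<gamma> :: real and K :: nat
    and x m :: "nat \<Rightarrow> 'w \<Rightarrow> 'a"
  assumes L_pos: "0 < L" and L_less_M: "L < M" and \<gamma>_pos: "0 < \<gamma>" and \<gamma>_le_1: "\<gamma> \<le> 1"
    and diff_f: "\<And>y. f differentiable (at y)"
    and bounded_below: "\<And>y. Fstar \<le> f y + \<psi> y"
    and smooth: "L_smooth L f"
    and unbiased: "unbiased_oracle D G f \<sigma>"
    and prob_P: "prob_space P"
    and samples: "samples_from D P \<xi>"
    and run: "prox_polyak_run P D G \<psi> \<xi> x0 mi \<gamma>i (\<lambda>_. M) (\<lambda>_. \<gamma>) K x m"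
    and init: "integrable P (\<lambda>\<omega>. (norm (m 0 \<omega> - grad f (x 0 \<omega>)))\<^sup>2)"
begin

sublocale prob_space P by (rule prob_P)

definition sq_err :: "nat \<Rightarrow> 'w \<Rightarrow> real" where
  "sq_err k \<omega> = (norm (m k \<omega> - grad f (x k \<omega>)))\<^sup>2"

definition sq_step :: "nat \<Rightarrow> 'w \<Rightarrow> real" where
  "sq_step k \<omega> = (norm (x (Suc k) \<omega> - x k \<omega>))\<^sup>2"

lemma sq_err_nonneg: "0 \<le> sq_err k \<omega>" and sq_step_nonneg: "0 \<le> sq_step k \<omega>"
  by (simp_all add: sq_err_def sq_step_def)

lemma x_measurable: "k \<le> K \<Longrightarrow> x k \<in> borel_measurable P"
  using run by (simp add: prox_polyak_run_def)

lemma x_init: "\<omega> \<in> space P \<Longrightarrow> x 0 \<omega> = x0"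
  using run by (simp add: prox_polyak_run_def)

lemma grad_measurable: "grad f \<in> borel_measurable borel"
  using L_smooth_continuous_grad[OF _ smooth] L_pos
  by (intro borel_measurable_continuous_onI) auto

lemma sq_step_measurable: "k < K \<Longrightarrow> sq_step k \<in> borel_measurable P"
  using x_measurable[of k] x_measurable[of "Suc k"] unfolding sq_step_def by simp

lemma objective_decrease:
  assumes "k < K" "\<omega> \<in> space P"
  shows "f (x (Suc k) \<omega>) + \<psi> (x (Suc k) \<omega>) + (M - L) / 4 * sq_step k \<omega>
           \<le> f (x k \<omega>) + \<psi> (x k \<omega>) + sq_err k \<omega> / (M - L)"
  unfolding sq_step_def sq_err_def
  using assms run by (intro prox_model_decrease diff_f smooth L_less_M) (simp add: prox_polyak_run_def)

text \<open>Telescoping; the lower bound on the objective turns this into a bound for the steps.\<close>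

lemma sum_sq_step_le:
  assumes "k \<le> K" "\<omega> \<in> space P"
  shows "(M - L) / 4 * (\<Sum>j<k. sq_step j \<omega>)
           \<le> f x0 + \<psi> x0 - Fstar + (\<Sum>j<k. sq_err j \<omega>) / (M - L)"
proof -
  have "f (x k \<omega>) + \<psi> (x k \<omega>) + (M - L) / 4 * (\<Sum>j<k. sq_step j \<omega>)
      \<le> f x0 + \<psi> x0 + (\<Sum>j<k. sq_err j \<omega>) / (M - L)"
    using assms(1)
  proof (induction k)
    case 0
    then show ?case using assms(2) by (simp add: x_init)
  next
    case (Suc k)
    with objective_decrease[of k \<omega>] assms(2) show ?case
      by (simp add: add_divide_distrib distrib_left)
  qed
  with bounded_below[of "x k \<omega>"] show ?thesis by linarith
qed

lemma integrable_sq_step: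
  assumes "k < K" and int: "\<And>j. j \<le> k \<Longrightarrow> integrable P (sq_err j)"
  shows "integrable P (sq_step k)"
proof -
  let ?b = "\<lambda>\<omega>. 4 / (M - L) * (f x0 + \<psi> x0 - Fstar + (\<Sum>j<Suc k. sq_err j \<omega>) / (M - L))"
  have "integrable P (\<lambda>\<omega>. \<Sum>j<Suc k. sq_err j \<omega>)"
    using int by (intro Bochner_Integration.integrable_sum) auto
  moreover have "integrable P (\<lambda>\<omega>. a * (b + T \<omega> / c))" if "integrable P T" for a b c :: real and T
    using that by simp
  ultimately have "integrable P ?b" by blast
  then show ?thesis
  proof (rule Bochner_Integration.integrable_bound)
    show "AE \<omega> in P. norm (sq_step k \<omega>) \<le> norm (?b \<omega>)"
    proof (rule AE_I2)
      fix \<omega> assume \<omega>: "\<omega> \<in> space P"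
      have "(M - L) / 4 * sq_step k \<omega> \<le> (M - L) / 4 * (\<Sum>j<Suc k. sq_step j \<omega>)"
        using L_less_M by (intro mult_left_mono member_le_sum) (auto simp: sq_step_nonneg)
      also have "\<dots> \<le> f x0 + \<psi> x0 - Fstar + (\<Sum>j<Suc k. sq_err j \<omega>) / (M - L)"
        using sum_sq_step_le[of "Suc k" \<omega>] assms(1) \<omega> by simp
      finally have "4 / (M - L) * ((M - L) / 4 * sq_step k \<omega>) \<le> ?b \<omega>"
        using L_less_M by (intro mult_left_mono) auto
      then have "sq_step k \<omega> \<le> ?b \<omega>" using L_less_M by simp
      then show "norm (sq_step k \<omega>) \<le> norm (?b \<omega>)" using sq_step_nonneg[of k \<omega>]
        unfolding real_norm_def by linarith
    qed
  qed (use assms sq_step_measurable in auto)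
qed

lemma sq_err_step:
  assumes k: "k < K" and int_err: "integrable P (sq_err k)" and int_step: "integrable P (sq_step k)"
  shows "integrable P (sq_err (Suc k))"
    and "expectation (sq_err (Suc k))
           \<le> (1 - \<gamma>) * expectation (sq_err k) + L\<^sup>2 / \<gamma> * expectation (sq_step k) + \<gamma>\<^sup>2 * \<sigma>\<^sup>2"
proof -
  let ?past = "borel \<Otimes>\<^sub>M (\<Pi>\<^sub>M i\<in>{..Suc k}. borel) \<Otimes>\<^sub>M (\<Pi>\<^sub>M i\<in>{..k}. borel)
    :: ('a \<times> (nat \<Rightarrow> 'a) \<times> (nat \<Rightarrow> 'a)) measure"
  let ?Y = "\<lambda>\<omega>. (mi \<omega>, \<lambda>i\<in>{..Suc k}. x i \<omega>, \<lambda>i\<in>{..k}. m i \<omega>)"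
  define h :: "'a \<times> (nat \<Rightarrow> 'a) \<times> (nat \<Rightarrow> 'a) \<Rightarrow> 'a \<times> 'a"
    where "h = (\<lambda>w. (fst (snd w) (Suc k), snd (snd w) k))"
  let ?u = "\<lambda>\<omega>. (norm (m k \<omega> - grad f (x (Suc k) \<omega>)))\<^sup>2"
  have ind: "indep_rvs P D (\<xi> (Suc k)) ?past ?Y"
    using run k by (simp add: prox_polyak_run_def)
  have h: "h \<in> measurable ?past (borel \<Otimes>\<^sub>M borel)"
    unfolding h_def by measurable
  have hY: "h (?Y \<omega>) = (x (Suc k) \<omega>, m k \<omega>)" for \<omega> by (simp add: h_def)
  have "(\<lambda>\<omega>. h (?Y \<omega>)) \<in> measurable P (borel \<Otimes>\<^sub>M borel)"
    using ind by (intro measurable_compose[OF _ h]) (simp add: indep_rvs_def)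
  then have "(\<lambda>\<omega>. (x (Suc k) \<omega>, m k \<omega>)) \<in> measurable P (borel \<Otimes>\<^sub>M borel)" by (simp add: hY)
  from measurable_compose[OF this measurable_fst] measurable_compose[OF this measurable_snd]
  have meas: "x (Suc k) \<in> borel_measurable P" "m k \<in> borel_measurable P" by simp_all
  have drift: "(norm (grad f (x k \<omega>) - grad f (x (Suc k) \<omega>)))\<^sup>2 \<le> L\<^sup>2 * sq_step k \<omega>" for \<omega>
  proof -
    have "norm (grad f (x k \<omega>) - grad f (x (Suc k) \<omega>)) \<le> L * norm (x k \<omega> - x (Suc k) \<omega>)"
      using smooth unfolding L_smooth_def by blast
    then have "(norm (grad f (x k \<omega>) - grad f (x (Suc k) \<omega>)))\<^sup>2
        \<le> (L * norm (x k \<omega> - x (Suc k) \<omega>))\<^sup>2"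
      by (intro power_mono) auto
    then show ?thesis by (simp add: power_mult_distrib sq_step_def norm_minus_commute)
  qed
  have split: "m k \<omega> - grad f (x (Suc k) \<omega>)
      = (m k \<omega> - grad f (x k \<omega>)) + (grad f (x k \<omega>) - grad f (x (Suc k) \<omega>))" for \<omega>
    by simp
  have int_u: "integrable P ?u"
  proof (rule Bochner_Integration.integrable_bound)
    show "integrable P (\<lambda>\<omega>. 2 * sq_err k \<omega> + 8 * (L\<^sup>2 * sq_step k \<omega>))"
      using int_err int_step by simp
    show "?u \<in> borel_measurable P"
      using meas grad_measurable by simp
    show "AE \<omega> in P. norm (?u \<omega>) \<le> norm (2 * sq_err k \<omega> + 8 * (L\<^sup>2 * sq_step k \<omega>))"
    proof (rule AE_I2)
      fix \<omega>
      (* the contraction-drift inequality with the factor one half, times four *)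
      have "?u \<omega> \<le> 2 * sq_err k \<omega> + 8 * (norm (grad f (x k \<omega>) - grad f (x (Suc k) \<omega>)))\<^sup>2"
        using norm_contraction_drift[of "1/2" "m k \<omega> - grad f (x k \<omega>)"
            "grad f (x k \<omega>) - grad f (x (Suc k) \<omega>)"]
        unfolding sq_err_def by (simp add: power2_eq_square)
      then show "norm (?u \<omega>) \<le> norm (2 * sq_err k \<omega> + 8 * (L\<^sup>2 * sq_step k \<omega>))"
        using drift[of \<omega>] by simp
    qed
  qed
  have mom: "sq_err (Suc k) \<omega>
      = (norm (polyak_update \<gamma> (m k \<omega>) (G (x (Suc k) \<omega>) (\<xi> (Suc k) \<omega>)) - grad f (x (Suc k) \<omega>)))\<^sup>2"
    if "\<omega> \<in> space P" for \<omega>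
    using run k that by (simp add: prox_polyak_run_def sq_err_def)
  have samp: "\<xi> (Suc k) \<in> measurable P D" "distr P D (\<xi> (Suc k)) = D"
    using samples by (auto simp: samples_from_def)
  note upd = polyak_update_expected_error[OF prob_P unbiased samp grad_measurable ind h hY int_u, of \<gamma>]
  show "integrable P (sq_err (Suc k))"
    using upd(1) mom by (simp cong: Bochner_Integration.integrable_cong)
  have "expectation (sq_err (Suc k)) \<le> (1 - \<gamma>)\<^sup>2 * expectation ?u + \<gamma>\<^sup>2 * \<sigma>\<^sup>2"
    using upd(2) mom by (simp cong: Bochner_Integration.integral_cong)
  also have "(1 - \<gamma>)\<^sup>2 * expectation ?u = expectation (\<lambda>\<omega>. (1 - \<gamma>)\<^sup>2 * ?u \<omega>)" by simp
  also have "\<dots> \<le> expectation (\<lambda>\<omega>. (1 - \<gamma>) * sq_err k \<omega> + L\<^sup>2 / \<gamma> * sq_step k \<omega>)"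
  proof (rule integral_mono)
    fix \<omega>
    have "(1 - \<gamma>)\<^sup>2 * ?u \<omega> \<le> (1 - \<gamma>) * sq_err k \<omega>
        + 1 / \<gamma> * (norm (grad f (x k \<omega>) - grad f (x (Suc k) \<omega>)))\<^sup>2"
      unfolding sq_err_def split[of \<omega>] by (rule norm_contraction_drift[OF \<gamma>_pos \<gamma>_le_1])
    also have "\<dots> \<le> (1 - \<gamma>) * sq_err k \<omega> + 1 / \<gamma> * (L\<^sup>2 * sq_step k \<omega>)"
      using drift \<gamma>_pos by (intro add_left_mono mult_left_mono) auto
    finally show "(1 - \<gamma>)\<^sup>2 * ?u \<omega> \<le> (1 - \<gamma>) * sq_err k \<omega> + L\<^sup>2 / \<gamma> * sq_step k \<omega>" by simp
  qed (use int_u int_err int_step in auto)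
  also have "\<dots> = (1 - \<gamma>) * expectation (sq_err k) + L\<^sup>2 / \<gamma> * expectation (sq_step k)"
    using int_err int_step by simp
  finally show "expectation (sq_err (Suc k))
      \<le> (1 - \<gamma>) * expectation (sq_err k) + L\<^sup>2 / \<gamma> * expectation (sq_step k) + \<gamma>\<^sup>2 * \<sigma>\<^sup>2" by simp
qed

text \<open>
  Square integrability passes from errors to steps and from steps to the next error, so it has to
  be carried through the same induction.
\<close>

lemma integrable_sq_err: "k \<le> K \<Longrightarrow> integrable P (sq_err k)"
proof (induction k rule: less_induct)
  case (less k)
  show ?case
  proof (cases k)
    case 0
    then show ?thesis using init by (simp add: sq_err_def)
  next
    case (Suc j)
    have "integrable P (sq_err i)" if "i \<le> j" for i using less that Suc by simp
    then show ?thesis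
      unfolding Suc using less.prems Suc
      by (intro sq_err_step(1) integrable_sq_step) auto
  qed
qed

text \<open>
  The error recursion charges \<open>L\<^sup>2 / \<gamma>\<close> per squared step, and the decrease of the objective
  bounds the steps by the errors with factor \<open>4 / (M - L)\<^sup>2\<close>.  The coupling of \<open>\<gamma>\<close> and \<open>M\<close> makes
  the product of the two equal to \<open>2 * \<gamma> / 9\<close>, so the errors can be absorbed.
\<close>

lemma sum_sq_err_le:
  assumes coupling: "\<gamma> * (M - L) = 3 * sqrt 2 * L"
  shows "7 / 9 * \<gamma> * (\<Sum>k=1..K. expectation (sq_err k))
           \<le> expectation (sq_err 0) + 4 * sqrt 2 * L * (f x0 + \<psi> x0 - Fstar) + real K * (\<gamma>\<^sup>2 * \<sigma>\<^sup>2)"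
proof -
  define N where "N = M - L"
  have N: "N > 0" using L_less_M by (simp add: N_def)
  define E where "E k = expectation (sq_err k)" for k
  define S where "S = (\<Sum>k=1..K. E k)"
  define R where "R = (\<Sum>k<K. expectation (sq_step k))"
  define F0 where "F0 = f x0 + \<psi> x0 - Fstar"
  have F0: "F0 \<ge> 0" using bounded_below[of x0] by (simp add: F0_def)
  have E_nonneg: "E k \<ge> 0" for k by (simp add: E_def sq_err_nonneg)
  have int_step: "integrable P (sq_step k)" if "k < K" for k
    using that by (intro integrable_sq_step integrable_sq_err) auto
  have shift: "S = (\<Sum>k<K. E (Suc k))"
    unfolding S_def by (rule sum.reindex_bij_witness[of _ Suc "\<lambda>k. k - 1"]) auto
  have past: "(\<Sum>k<K. E k) \<le> E 0 + S"
  proof -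
    have "(\<Sum>k<K. E k) \<le> (\<Sum>k<Suc K. E k)" using E_nonneg by simp
    also have "\<dots> = E 0 + S" unfolding shift by (rule sum.lessThan_Suc_shift)
    finally show ?thesis .
  qed
  have "S \<le> (\<Sum>k<K. (1 - \<gamma>) * E k + L\<^sup>2 / \<gamma> * expectation (sq_step k) + \<gamma>\<^sup>2 * \<sigma>\<^sup>2)"
    unfolding shift E_def
    by (intro sum_mono sq_err_step(2) integrable_sq_err int_step) auto
  also have "\<dots> = (1 - \<gamma>) * (\<Sum>k<K. E k) + L\<^sup>2 / \<gamma> * R + real K * (\<gamma>\<^sup>2 * \<sigma>\<^sup>2)"
    by (simp add: sum.distrib sum_distrib_left R_def)
  also have "\<dots> \<le> (1 - \<gamma>) * (E 0 + S) + L\<^sup>2 / \<gamma> * R + real K * (\<gamma>\<^sup>2 * \<sigma>\<^sup>2)"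
    using past \<gamma>_le_1 by (intro add_right_mono mult_left_mono) auto
  finally have rec: "\<gamma> * S \<le> (1 - \<gamma>) * E 0 + L\<^sup>2 / \<gamma> * R + real K * (\<gamma>\<^sup>2 * \<sigma>\<^sup>2)"
    by (simp add: algebra_simps)
  have "N / 4 * R = expectation (\<lambda>\<omega>. N / 4 * (\<Sum>j<K. sq_step j \<omega>))"
    using int_step by (simp add: R_def)
  also have "\<dots> \<le> expectation (\<lambda>\<omega>. F0 + (\<Sum>j<K. sq_err j \<omega>) / N)"
  proof (rule integral_mono)
    show "N / 4 * (\<Sum>j<K. sq_step j \<omega>) \<le> F0 + (\<Sum>j<K. sq_err j \<omega>) / N"
      if "\<omega> \<in> space P" for \<omega>
      using sum_sq_step_le[of K \<omega>] that by (simp add: N_def F0_def)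
    show "integrable P (\<lambda>\<omega>. N / 4 * (\<Sum>j<K. sq_step j \<omega>))"
      using int_step by (intro integrable_mult_right Bochner_Integration.integrable_sum) auto
    show "integrable P (\<lambda>\<omega>. F0 + (\<Sum>j<K. sq_err j \<omega>) / N)"
      using integrable_sq_err
      by (intro Bochner_Integration.integrable_add integrable_divide_zero
          Bochner_Integration.integrable_sum) auto
  qed
  also have "\<dots> = F0 + (\<Sum>j<K. E j) / N"
  proof -
    have "integrable P (\<lambda>\<omega>. (\<Sum>j<K. sq_err j \<omega>) / N)"
      using integrable_sq_err
      by (intro integrable_divide_zero Bochner_Integration.integrable_sum) auto
    then show ?thesis using integrable_sq_err by (simp add: prob_space E_def)
  qed
  also have "\<dots> \<le> F0 + (E 0 + S) / N"
    using past N by (simp add: divide_right_mono)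
  finally have scaled: "4 * L\<^sup>2 / (\<gamma> * N) * (N / 4 * R) \<le> 4 * L\<^sup>2 / (\<gamma> * N) * (F0 + (E 0 + S) / N)"
    using N \<gamma>_pos by (intro mult_left_mono) auto
  have gap_gain: "L\<^sup>2 / (\<gamma> * N) = sqrt 2 / 6 * L"
    using L_pos coupling by (simp add: N_def power2_eq_square field_simps)
  have error_gain: "L\<^sup>2 / (\<gamma> * N\<^sup>2) = \<gamma> / 18"
  proof -
    have "(\<gamma> * N)\<^sup>2 = 18 * L\<^sup>2" using coupling by (simp add: N_def power_mult_distrib)
    then show ?thesis using N \<gamma>_pos by (simp add: field_simps power2_eq_square)
  qed
  have "L\<^sup>2 / \<gamma> * R = 4 * L\<^sup>2 / (\<gamma> * N) * (N / 4 * R)" using N \<gamma>_pos by simp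
  also note scaled
  also have "4 * L\<^sup>2 / (\<gamma> * N) * (F0 + (E 0 + S) / N)
      = 4 * (L\<^sup>2 / (\<gamma> * N)) * F0 + 4 * (L\<^sup>2 / (\<gamma> * N\<^sup>2)) * (E 0 + S)"
    by (simp add: power2_eq_square distrib_left add_divide_distrib mult_ac)
  also have "\<dots> = 2 / 3 * (sqrt 2 * (L * F0)) + 2 / 9 * (\<gamma> * E 0) + 2 / 9 * (\<gamma> * S)"
    unfolding gap_gain error_gain by (simp add: algebra_simps)
  finally have "L\<^sup>2 / \<gamma> * R \<le> 2 / 3 * (sqrt 2 * (L * F0)) + 2 / 9 * (\<gamma> * E 0) + 2 / 9 * (\<gamma> * S)" .
  with rec have "7 / 9 * (\<gamma> * S) \<le> E 0 - 7 / 9 * (\<gamma> * E 0) + 2 / 3 * (sqrt 2 * (L * F0))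
      + real K * (\<gamma>\<^sup>2 * \<sigma>\<^sup>2)"
    by (simp add: algebra_simps)
  moreover have "0 \<le> \<gamma> * E 0" "0 \<le> sqrt 2 * (L * F0)" using \<gamma>_pos E_nonneg L_pos F0 by auto
  ultimately have "7 / 9 * (\<gamma> * S) \<le> E 0 + 4 * (sqrt 2 * (L * F0)) + real K * (\<gamma>\<^sup>2 * \<sigma>\<^sup>2)" by linarith
  then show ?thesis by (simp add: S_def E_def F0_def mult.assoc)
qed

end

section \<open>Averaging over a uniform index\<close>

lemma integral_with_uniform_index:
  fixes h :: "nat \<Rightarrow> 'w \<Rightarrow> real"
  assumes P: "prob_space P" and K: "1 \<le> K" and int: "\<And>t. t \<in> {1..K} \<Longrightarrow> integrable P (h t)"
  shows "integrable (with_uniform_index K P) (\<lambda>(t, \<omega>). h t \<omega>)"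
    and "(\<integral>(t, \<omega>). h t \<omega> \<partial>with_uniform_index K P) = (\<Sum>t=1..K. \<integral>\<omega>. h t \<omega> \<partial>P) / real K"
proof -
  interpret P: prob_space P by fact
  interpret U: prob_space "uniform_count_measure {1..K}"
    using K by (intro prob_space_uniform_count_measure) auto
  interpret pair_sigma_finite "uniform_count_measure {1..K}" P ..
  have "(\<lambda>(t, \<omega>). h t \<omega>) \<in> borel_measurable (count_space {1..K} \<Otimes>\<^sub>M P)"
    using int by (intro measurable_pair_measure_countable1) auto
  then have meas: "(\<lambda>(t, \<omega>). h t \<omega>) \<in> borel_measurable (with_uniform_index K P)"
    by (simp add: sets_uniform_count_measure_count_space cong: measurable_cong_sets sets_pair_measure_cong)
  have fin: "integrable (uniform_count_measure {1..K}) g" for g :: "nat \<Rightarrow> real"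
    unfolding uniform_count_measure_def by (rule integrable_point_measure_finite) simp
  show int_pair: "integrable (with_uniform_index K P) (\<lambda>(t, \<omega>). h t \<omega>)"
    using meas int by (intro Fubini_integrable fin AE_I2) (auto simp: space_uniform_count_measure)
  have "(\<integral>(t, \<omega>). h t \<omega> \<partial>with_uniform_index K P)
      = (\<integral>t. (\<integral>\<omega>. h t \<omega> \<partial>P) \<partial>uniform_count_measure {1..K})"
    using integral_fst'[OF int_pair] by simp
  also have "\<dots> = (\<Sum>t=1..K. \<integral>\<omega>. h t \<omega> \<partial>P) / real K"
    by (subst integral_uniform_count_measure) auto
  finally show "(\<integral>(t, \<omega>). h t \<omega> \<partial>with_uniform_index K P) = (\<Sum>t=1..K. \<integral>\<omega>. h t \<omega> \<partial>P) / real K" .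
qed

section \<open>The number of iterations\<close>

lemma sqrt2_bounds: "(7/5 :: real) \<le> sqrt 2" "sqrt 2 \<le> (3/2 :: real)"
  by (rule real_le_rsqrt, simp add: power2_eq_square) (rule real_le_lsqrt, simp_all add: power2_eq_square)

text \<open>
  The weight of the noise term in the prescribed \<open>M\<close>; its square is \<open>27 / (2 * sqrt 2)\<close>, roughly \<open>9.55\<close>.
\<close>

lemma momentum_const_bounds:
  "3 \<le> (3::real) powr (3/2) / 2 powr (3/4)" "(3::real) powr (3/2) / 2 powr (3/4) \<le> 16 / 5"
proof -
  define c where "c = (3::real) powr (3/2) / 2 powr (3/4)"
  have "((3::real) powr (3/2))\<^sup>2 = 3 powr 3" by (simp add: powr_power)
  moreover have "((2::real) powr (3/4))\<^sup>2 = 2 powr (1 + 1/2)" by (simp add: powr_power)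
  moreover have "\<dots> = 2 * sqrt 2" by (subst powr_add) (simp add: powr_half_sqrt)
  ultimately have sq: "c\<^sup>2 = 27 / (2 * sqrt 2)" by (simp add: c_def power_divide)
  note sqrt2_bounds
  then have "3\<^sup>2 \<le> c\<^sup>2" "c\<^sup>2 \<le> (16/5)\<^sup>2"
    unfolding sq by (auto simp: field_simps)
  moreover have "c \<ge> 0" by (simp add: c_def)
  ultimately show "3 \<le> (3::real) powr (3/2) / 2 powr (3/4)"
    "(3::real) powr (3/2) / 2 powr (3/4) \<le> 16 / 5"
    unfolding c_def[symmetric] by (auto intro: power2_le_imp_le)
qed

text \<open>
  The choice of \<open>M\<close> balances the two contributions to the average error: with
  \<open>r = sqrt (L * \<Phi> * \<sigma>\<^sup>2 / K)\<close>, the initial potential contributes \<open>L * \<Phi> / (\<gamma> * K)\<close>, where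
  \<open>1 / \<gamma>\<close> exceeds \<open>1\<close> by a multiple of \<open>r * K / (L * \<Phi>)\<close>, and the noise contributes
  \<open>\<gamma> * \<sigma>\<^sup>2\<close>; both are of order \<open>L * \<Phi> / K + r\<close>.
\<close>

lemma average_error_rate:
  fixes L \<Phi> \<sigma> M \<gamma> S :: real and K :: nat
  assumes "0 < L" "0 < \<Phi>" "1 \<le> K"
    and M: "M = (1 + 3 * sqrt 2) * L + 3 powr (3/2) / 2 powr (3/4) * sqrt (real K * L * \<sigma>\<^sup>2 / \<Phi>)"
    and \<gamma>: "\<gamma> = 3 * sqrt 2 * L / (M - L)"
    and S: "7 / 9 * \<gamma> * S \<le> 4 * sqrt 2 * L * \<Phi> + real K * (\<gamma>\<^sup>2 * \<sigma>\<^sup>2)"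
  shows "S / real K \<le> 8 * (L * \<Phi> / real K) + 8 * sqrt (L * \<Phi> * \<sigma>\<^sup>2 / real K)"
proof -
  define c where "c = (3::real) powr (3/2) / 2 powr (3/4)"
  have c: "3 \<le> c" "c \<le> 16 / 5" using momentum_const_bounds by (auto simp: c_def)
  define k where "k = real K"
  have k: "k \<ge> 1" using assms by (simp add: k_def)
  define r where "r = sqrt (L * \<Phi> * \<sigma>\<^sup>2 / k)"
  define A where "A = c * (r * k / \<Phi>)"
  have r0: "r \<ge> 0" using assms k by (simp add: r_def)
  have A0: "A \<ge> 0" using r0 c k assms by (simp add: A_def)
  have r2: "r\<^sup>2 = L * \<Phi> * \<sigma>\<^sup>2 / k" using assms k by (simp add: r_def)
  have "sqrt (k * L * \<sigma>\<^sup>2 / \<Phi>) = r * k / \<Phi>"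
  proof (rule real_sqrt_unique)
    show "(r * k / \<Phi>)\<^sup>2 = k * L * \<sigma>\<^sup>2 / \<Phi>"
      using assms k r2 by (simp add: power_divide power_mult_distrib power2_eq_square field_simps)
  qed (use r0 k assms in auto)
  then have N: "M - L = 3 * sqrt 2 * L + A"
    unfolding M k_def[symmetric] c_def[symmetric] A_def by (simp add: algebra_simps)
  have N0: "M - L > 0" unfolding N using A0 assms by (simp add: add_pos_nonneg)
  have g0: "\<gamma> > 0" unfolding \<gamma> using N0 assms by simp
  have gN: "\<gamma> * (3 * sqrt 2 * L + A) = 3 * sqrt 2 * L" unfolding N[symmetric] \<gamma> using N0 by simp
  note s2 = sqrt2_bounds
  (* once the potential term is a multiple of the momentum weight, the weight cancels from the
     hypothesis on S *)
  have potential: "4 * sqrt 2 * L * \<Phi> = \<gamma> * (4 * sqrt 2 * L * \<Phi> + 4 / 3 * (c * (r * k)))"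
  proof -
    have "4 * sqrt 2 * L * \<Phi> = 4 / 3 * \<Phi> * (\<gamma> * (3 * sqrt 2 * L + A))" unfolding gN by simp
    also have "\<dots> = \<gamma> * (4 * sqrt 2 * L * \<Phi> + 4 / 3 * (c * (r * k)))"
      using \<open>0 < \<Phi>\<close> by (simp add: A_def algebra_simps)
    finally show ?thesis .
  qed
  have noise: "\<gamma> * \<sigma>\<^sup>2 \<le> sqrt 2 * r"
  proof (cases "r = 0")
    case True
    then have "\<sigma>\<^sup>2 = 0" using r2 assms k by simp
    then show ?thesis using True by simp
  next
    case False
    with r0 have r: "r > 0" by simp
    have s: "\<sigma>\<^sup>2 = r\<^sup>2 * k / (L * \<Phi>)" using r2 assms k by (simp add: field_simps)
    have "0 \<le> \<gamma> * (3 * sqrt 2 * L)" using g0 \<open>0 < L\<close> by (intro mult_nonneg_nonneg) auto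
    then have "\<gamma> * A \<le> 3 * sqrt 2 * L" using gN unfolding distrib_left by linarith
    moreover have "\<gamma> * (3 * (r * k / \<Phi>)) \<le> \<gamma> * A"
      unfolding A_def using c g0 r k assms by (intro mult_left_mono mult_right_mono) auto
    ultimately have "3 * (\<gamma> * (r * k / \<Phi>)) \<le> 3 * (sqrt 2 * L)" by (simp only: mult_ac)
    then have "\<gamma> * (r * k / \<Phi>) \<le> sqrt 2 * L" by linarith
    then have "\<gamma> * (r * k / \<Phi>) * (r / L) \<le> sqrt 2 * L * (r / L)"
      using r assms by (intro mult_right_mono) auto
    then show ?thesis using \<open>0 < L\<close> unfolding s by (simp add: power2_eq_square mult_ac)
  qed
  have "\<gamma> * (7 / 9 * S) \<le> \<gamma> * (4 * sqrt 2 * L * \<Phi> + 4 / 3 * (c * (r * k)) + k * (\<gamma> * \<sigma>\<^sup>2))"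
  proof -
    have "\<gamma> * (7 / 9 * S) = 7 / 9 * \<gamma> * S" by simp
    moreover have "\<gamma> * (k * (\<gamma> * \<sigma>\<^sup>2)) = k * (\<gamma>\<^sup>2 * \<sigma>\<^sup>2)" by (simp add: power2_eq_square)
    ultimately show ?thesis
      using S potential unfolding k_def[symmetric] distrib_left by linarith
  qed
  then have "7 / 9 * S \<le> 4 * sqrt 2 * L * \<Phi> + 4 / 3 * (c * (r * k)) + k * (\<gamma> * \<sigma>\<^sup>2)"
    using g0 by simp
  also have "\<dots> \<le> 4 * (3/2) * L * \<Phi> + 4 / 3 * (16/5 * (r * k)) + k * (3/2 * r)"
  proof (intro add_mono mult_left_mono)
    show "\<gamma> * \<sigma>\<^sup>2 \<le> 3/2 * r" using noise mult_right_mono[OF s2(2) r0] by linarith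
    show "4 * sqrt 2 * L * \<Phi> \<le> 4 * (3/2) * L * \<Phi>"
      using s2 assms by (intro mult_right_mono) auto
    show "c * (r * k) \<le> 16/5 * (r * k)" using c r0 k by (intro mult_right_mono) auto
  qed (use k in auto)
  also have "\<dots> \<le> 7 / 9 * (8 * (L * \<Phi>) + 8 * (r * k))"
    using mult_nonneg_nonneg[OF r0, of k] k mult_pos_pos[OF assms(1,2)]
    by (simp add: algebra_simps)
  finally have "S \<le> 8 * (L * \<Phi>) + 8 * (r * k)" by simp
  then have "S / k \<le> (8 * (L * \<Phi>) + 8 * (r * k)) / k" using k by (intro divide_right_mono) auto
  also have "\<dots> = 8 * (L * \<Phi> / k) + 8 * r" using k by (simp add: field_simps)
  finally show ?thesis by (simp add: k_def r_def)
qed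

text \<open>
  With the factor \<open>100\<close> the two terms are at most \<open>8 / 100\<close> and \<open>8 / 10\<close> of \<open>\<epsilon>\<close>; the square root
  in the second one decides how large the factor has to be.
\<close>

lemma iteration_count_suffices:
  fixes q \<sigma> \<epsilon> k :: real
  assumes "0 < q" "0 < \<epsilon>" and k: "100 * (q * \<sigma>\<^sup>2 / \<epsilon>\<^sup>2 + q / \<epsilon>) \<le> k"
  shows "8 * (q / k) + 8 * sqrt (q * \<sigma>\<^sup>2 / k) \<le> \<epsilon>"
proof -
  have a: "0 < q / \<epsilon>" "0 \<le> q * \<sigma>\<^sup>2 / \<epsilon>\<^sup>2" using assms by auto
  with k have k0: "0 < k" and k1: "100 * (q / \<epsilon>) \<le> k" and k2: "100 * (q * \<sigma>\<^sup>2 / \<epsilon>\<^sup>2) \<le> k"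
    by argo+
  have "q / k \<le> \<epsilon> / 100" using k1 k0 assms by (simp add: field_simps)
  moreover have "sqrt (q * \<sigma>\<^sup>2 / k) \<le> \<epsilon> / 10"
  proof (rule real_le_lsqrt)
    show "q * \<sigma>\<^sup>2 / k \<le> (\<epsilon> / 10)\<^sup>2" using k2 k0 assms by (simp add: field_simps power2_eq_square)
  qed (use assms k0 in auto)
  ultimately show ?thesis using assms by linarith
qed

theorem theorem2:
  "\<exists>C. absolute_const C \<and>
    (\<forall>(f :: real^'n \<Rightarrow> real) (\<psi> :: real^'n \<Rightarrow> real) (Fstar :: real) (L :: real) (\<sigma> :: real)
       (D :: 's measure) (G :: real^'n \<Rightarrow> 's \<Rightarrow> real^'n)
       (P :: 'w measure) (\<xi> :: nat \<Rightarrow> 'w \<Rightarrow> 's)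
       (x0 :: real^'n) (mi :: 'w \<Rightarrow> real^'n) (\<gamma>i :: real) (\<epsilon> :: real)
       (F0 :: real) (m0 :: 'w \<Rightarrow> real^'n) (\<Phi>0 :: real).
       0 < L \<and> 0 \<le> \<sigma> \<and> 0 < \<epsilon> \<and>
       (\<forall>x. f differentiable (at x)) \<and> (\<forall>x. \<psi> differentiable (at x)) \<and>
       (\<forall>x. Fstar \<le> f x + \<psi> x) \<and> L_smooth L f \<and>
       unbiased_oracle D G f \<sigma> \<and>
       prob_space P \<and> samples_from D P \<xi> \<and> mi \<in> borel_measurable P \<and>
       F0 = f x0 + \<psi> x0 - Fstar \<and>
       m0 = (\<lambda>\<omega>. polyak_update \<gamma>i (mi \<omega>) (G x0 (\<xi> 0 \<omega>))) \<and>
       integrable P (\<lambda>\<omega>. (norm (m0 \<omega> - grad f x0))\<^sup>2) \<and>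
       \<Phi>0 = F0 + sqrt 2 / (8 * L) * (\<integral>\<omega>. (norm (m0 \<omega> - grad f x0))\<^sup>2 \<partial>P) \<and>
       0 < \<Phi>0
       \<longrightarrow>
       (\<exists>K::nat. 1 \<le> K \<and>
          int K \<le> \<lceil>C * (L * \<Phi>0 * \<sigma>\<^sup>2 / \<epsilon>\<^sup>2 + L * \<Phi>0 / \<epsilon>)\<rceil> \<and>
          (\<forall>(M :: real) (\<gamma> :: real) (x :: nat \<Rightarrow> 'w \<Rightarrow> real^'n) (m :: nat \<Rightarrow> 'w \<Rightarrow> real^'n).
             M = (1 + 3 * sqrt 2) * L
                 + 3 powr (3 / 2) / 2 powr (3 / 4) * sqrt (real K * L * \<sigma>\<^sup>2 / \<Phi>0) \<and>
             \<gamma> = 3 * sqrt 2 * L / (M - L) \<and>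
             prox_polyak_run P D G \<psi> \<xi> x0 mi \<gamma>i (\<lambda>_. M) (\<lambda>_. \<gamma>) K x m \<and>
             exact_prox_steps P \<psi> (\<lambda>_. M) K x m
             \<longrightarrow>
             integrable (with_uniform_index K P)
               (\<lambda>(t, \<omega>). (norm (m t \<omega> - grad f (x t \<omega>)))\<^sup>2) \<and>
             (\<integral>(t, \<omega>). (norm (m t \<omega> - grad f (x t \<omega>)))\<^sup>2 \<partial>with_uniform_index K P) \<le> \<epsilon>)))"
proof (intro exI[of _ "100::real"] conjI allI impI, goal_cases)
  case 1
  show ?case by (simp add: absolute_const_def)
next
  case (2 f \<psi> Fstar L \<sigma> D G P \<xi> x0 mi \<gamma>i \<epsilon> F0 m0 \<Phi>0)
  then have L: "0 < L" and eps: "0 < \<epsilon>"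
    and diff_f: "\<And>y. f differentiable (at y)"
    and lower: "\<And>y. Fstar \<le> f y + \<psi> y" and smooth: "L_smooth L f"
    and noisy: "unbiased_oracle D G f \<sigma>" and P: "prob_space P" and samples: "samples_from D P \<xi>"
    and F0: "F0 = f x0 + \<psi> x0 - Fstar"
    and m0: "m0 = (\<lambda>\<omega>. polyak_update \<gamma>i (mi \<omega>) (G x0 (\<xi> 0 \<omega>)))"
    and int_m0: "integrable P (\<lambda>\<omega>. (norm (m0 \<omega> - grad f x0))\<^sup>2)"
    and \<Phi>0: "\<Phi>0 = F0 + sqrt 2 / (8 * L) * (\<integral>\<omega>. (norm (m0 \<omega> - grad f x0))\<^sup>2 \<partial>P)"
    and \<Phi>0_pos: "0 < \<Phi>0"
    by blast+
  define B where "B = 100 * (L * \<Phi>0 * \<sigma>\<^sup>2 / \<epsilon>\<^sup>2 + L * \<Phi>0 / \<epsilon>)"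
  define K where "K = nat \<lceil>B\<rceil>"
  have B: "B > 0" using L eps \<Phi>0_pos unfolding B_def by (simp add: add_nonneg_pos)
  have K1: "1 \<le> K" and KB: "int K = \<lceil>B\<rceil>" using B by (auto simp: K_def le_nat_iff)
  have BK: "B \<le> real K" using KB by linarith
  show ?case
  proof (intro exI[of _ K] conjI allI impI K1, unfold B_def[symmetric])
    show "int K \<le> \<lceil>B\<rceil>" using KB by simp
  next
    fix M \<gamma> :: real and x m :: "nat \<Rightarrow> 'w \<Rightarrow> real^'n"
    assume "M = (1 + 3 * sqrt 2) * L
          + 3 powr (3 / 2) / 2 powr (3 / 4) * sqrt (real K * L * \<sigma>\<^sup>2 / \<Phi>0) \<and>
        \<gamma> = 3 * sqrt 2 * L / (M - L) \<and>
        prox_polyak_run P D G \<psi> \<xi> x0 mi \<gamma>i (\<lambda>_. M) (\<lambda>_. \<gamma>) K x m \<and>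
        exact_prox_steps P \<psi> (\<lambda>_. M) K x m"
    then have M: "M = (1 + 3 * sqrt 2) * L
          + 3 powr (3 / 2) / 2 powr (3 / 4) * sqrt (real K * L * \<sigma>\<^sup>2 / \<Phi>0)"
      and \<gamma>: "\<gamma> = 3 * sqrt 2 * L / (M - L)"
      and run: "prox_polyak_run P D G \<psi> \<xi> x0 mi \<gamma>i (\<lambda>_. M) (\<lambda>_. \<gamma>) K x m"
      by blast+
    have "0 \<le> 3 powr (3 / 2) / 2 powr (3 / 4) * sqrt (real K * L * \<sigma>\<^sup>2 / \<Phi>0)"
      using L \<Phi>0_pos by simp
    then have gap: "3 * sqrt 2 * L \<le> M - L" unfolding M by (simp add: algebra_simps)
    have pos: "0 < 3 * sqrt 2 * L" using L by simp
    have LM: "L < M" using gap pos by linarith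
    have "0 < \<gamma>" unfolding \<gamma> using LM pos by (intro divide_pos_pos) linarith+
    moreover have "\<gamma> \<le> 1" unfolding \<gamma> using LM gap by (subst divide_le_eq_1_pos) linarith+
    ultimately have \<gamma>01: "0 < \<gamma>" "\<gamma> \<le> 1" by auto
    have initial_error: "m 0 \<omega> - grad f (x 0 \<omega>) = m0 \<omega> - grad f x0" if "\<omega> \<in> space P" for \<omega>
      using run that by (simp add: prox_polyak_run_def m0)
    have init: "integrable P (\<lambda>\<omega>. (norm (m 0 \<omega> - grad f (x 0 \<omega>)))\<^sup>2)"
      using int_m0 initial_error by (simp cong: Bochner_Integration.integrable_cong)
    interpret R: prox_polyak f \<psi> Fstar L \<sigma> D G P \<xi> x0 mi \<gamma>i M \<gamma> K x m
      by (rule prox_polyak.intro) fact+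
    let ?S = "\<Sum>k=1..K. R.expectation (R.sq_err k)"
    have "R.expectation (R.sq_err 0) = (\<integral>\<omega>. (norm (m0 \<omega> - grad f x0))\<^sup>2 \<partial>P)"
      unfolding R.sq_err_def using initial_error by (simp cong: Bochner_Integration.integral_cong)
    then have "R.expectation (R.sq_err 0) + 4 * sqrt 2 * L * (f x0 + \<psi> x0 - Fstar)
        = 4 * sqrt 2 * L * \<Phi>0"
      using L by (simp add: \<Phi>0 F0 field_simps)
    moreover have "\<gamma> * (M - L) = 3 * sqrt 2 * L" using LM by (simp add: \<gamma>)
    ultimately have "7 / 9 * \<gamma> * ?S \<le> 4 * sqrt 2 * L * \<Phi>0 + real K * (\<gamma>\<^sup>2 * \<sigma>\<^sup>2)"
      using R.sum_sq_err_le by simp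
    then have "?S / real K \<le> 8 * (L * \<Phi>0 / real K) + 8 * sqrt (L * \<Phi>0 * \<sigma>\<^sup>2 / real K)"
      using average_error_rate[OF L \<Phi>0_pos K1 M \<gamma>] by simp
    also have "\<dots> \<le> \<epsilon>"
      using L \<Phi>0_pos eps BK unfolding B_def by (intro iteration_count_suffices) auto
    finally have avg: "?S / real K \<le> \<epsilon>" .
    have int: "integrable P (R.sq_err t)" if "t \<in> {1..K}" for t
      using that by (simp add: R.integrable_sq_err)
    note uniform = integral_with_uniform_index[OF P K1, of R.sq_err]
    have "integrable (with_uniform_index K P) (\<lambda>(t, \<omega>). R.sq_err t \<omega>)"
      using int by (rule uniform(1))
    then show "integrable (with_uniform_index K P) (\<lambda>(t, \<omega>). (norm (m t \<omega> - grad f (x t \<omega>)))\<^sup>2)"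
      by (simp only: R.sq_err_def)
    have "(\<integral>(t, \<omega>). R.sq_err t \<omega> \<partial>with_uniform_index K P) = ?S / real K"
      using int by (rule uniform(2))
    with avg have "(\<integral>(t, \<omega>). R.sq_err t \<omega> \<partial>with_uniform_index K P) \<le> \<epsilon>" by simp
    then show "(\<integral>(t, \<omega>). (norm (m t \<omega> - grad f (x t \<omega>)))\<^sup>2 \<partial>with_uniform_index K P) \<le> \<epsilon>"
      by (simp only: R.sq_err_def)
  qed
qed

end
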